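(* Let $G$ be a finite simple graph and let $i$ and $j$ be positive integers. Then $G$ is an $\langle i,j\rangle$ competition graph if and only if (i) $G\not\cong K_2$, (ii) if $j=1$ then $G$ is not a nontrivial complete graph (i.e. not $K_n$ with $n\ge 2$), and (iii) $\mathbf{C}(G,i,j)\neq\emptyset$.
   Context: All digraphs are finite, without loops and without parallel arcs; all graphs are finite and simple. The competition graph of a digraph $D$ has vertex set $V(D)$ and an edge $uv$ ($u\ne v$) iff $u$ and $v$ have a common out-neighbor in $D$. For positive integers $i,j$, an $\langle i,j\rangle$ digraph is a loopless digraph in which every vertex has indegree at most $i$ and outdegree at most $j$ (not necessarily acyclic). An $\langle i,j\rangle$ competition graph is the competition graph of some $\langle i,j\rangle$ digraph. Cliques are identified with their vertex sets; an edge clique cover of $G$ is a collection of cliques covering all edges of $G$. $\mathbf{C}(G,i,j)$ denotes the set of edge clique covers $\mathcal{C}=\{C_1,\ldots,C_p\}$ of $G$ such that $|C_t|\le i$ for every $t$, each vertex of $G$ lies in at most $j$ cliques of $\mathcal{C}$, and $p\le |V(G)|$. *)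

theory Defs
  imports "Graph_Theory.Graph_Theory"
begin

text \<open>
  Digraphs are finite, loopless and without parallel arcs (locale \<^locale>\<open>pair_digraph\<close>); a finite
  simple graph is a symmetric such digraph (locale \<^locale>\<open>pair_graph\<close>), an edge \<open>uv\<close> being
  represented by the two arcs \<open>(u, v)\<close> and \<open>(v, u)\<close>. As in the library, the null graph is allowed.
\<close>

definition competition_graph :: "'a pair_pre_digraph \<Rightarrow> 'a pair_pre_digraph" where
  "competition_graph D = \<lparr> pverts = pverts D,
     parcs = {(u, v). u \<in> pverts D \<and> v \<in> pverts D \<and> u \<noteq> v \<and>
                (\<exists>w \<in> pverts D. (u, w) \<in> parcs D \<and> (v, w) \<in> parcs D)} \<rparr>"

lemma pair_graph_competition_graph:
  assumes "pair_digraph D"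
  shows "pair_graph (competition_graph D)"
proof -
  interpret D: pair_digraph D by fact
  have "parcs (competition_graph D) \<subseteq> pverts D \<times> pverts D"
    by (auto simp: competition_graph_def)
  then have "finite (parcs (competition_graph D))"
    by (rule finite_subset) (simp add: D.pair_finite_verts)
  then show ?thesis
    by unfold_locales
      (auto simp: competition_graph_def symmetric_def D.pair_finite_verts intro!: symI)
qed

definition bounded_digraph :: "nat \<Rightarrow> nat \<Rightarrow> 'a pair_pre_digraph \<Rightarrow> bool" where
  "bounded_digraph i j D \<longleftrightarrow> pair_digraph D \<and>
     (\<forall>v \<in> pverts D. in_degree (with_proj D) v \<le> i \<and> out_degree (with_proj D) v \<le> j)"

definition bounded_competition_graph :: "nat \<Rightarrow> nat \<Rightarrow> 'a pair_pre_digraph \<Rightarrow> bool" where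
  "bounded_competition_graph i j G \<longleftrightarrow> (\<exists>D. bounded_digraph i j D \<and> G = competition_graph D)"

definition clique :: "'a pair_pre_digraph \<Rightarrow> 'a set \<Rightarrow> bool" where
  "clique G C \<longleftrightarrow> C \<subseteq> pverts G \<and> (\<forall>u \<in> C. \<forall>v \<in> C. u \<noteq> v \<longrightarrow> (u, v) \<in> parcs G)"

definition edge_clique_cover :: "'a pair_pre_digraph \<Rightarrow> 'a set set \<Rightarrow> bool" where
  "edge_clique_cover G \<C> \<longleftrightarrow> (\<forall>C \<in> \<C>. clique G C) \<and>
     (\<forall>(u, v) \<in> parcs G. \<exists>C \<in> \<C>. u \<in> C \<and> v \<in> C)"

text \<open>
  The set \<open>\<^bold>C(G, i, j)\<close>. For finite \<open>G\<close> all cardinalities below are those of finite sets, as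
  \<open>\<C>\<close> consists of subsets of the vertex set.
\<close>

definition bounded_edge_clique_covers :: "'a pair_pre_digraph \<Rightarrow> nat \<Rightarrow> nat \<Rightarrow> 'a set set set" where
  "bounded_edge_clique_covers G i j = {\<C>. edge_clique_cover G \<C> \<and>
     (\<forall>C \<in> \<C>. card C \<le> i) \<and>
     (\<forall>v \<in> pverts G. card {C \<in> \<C>. v \<in> C} \<le> j) \<and>
     card \<C> \<le> card (pverts G)}"

end

(* Competition graphs correspond to clique covers through in-neighbourhoods; conversely, a cover
   comes from a loopless digraph as soon as its cliques can be assigned distinct vertices, each
   outside its clique. By Hall's theorem this requires |S| + |K| <= |V| for every nonempty
   subfamily S with intersection K. In a cover of least total size every vertex v of a clique C has
   a partner u in C such that C is the only clique containing both. So if S has at least two members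
   and K contains v, the partners of v in the members of S are distinct and lie outside K, which is
   Hall's condition. It can only fail if V itself is a clique of the cover; then G is complete and
   the cover V - {a}, V - {b}, {a, b} can be used instead. *)

theory Submission
  imports Defs
begin

section \<open>Hall's marriage theorem\<close>

text \<open>Induction in the style of Halmos and Vaughan. If some nonempty proper subfamily is
  tight, it is matched inside its union and the remaining sets outside that union. Otherwise every
  such subfamily has a surplus, so one element can be given away freely. As infinite sets have
  \<open>card\<close> 0, the condition on singletons also forces each \<open>A k\<close> to be
  finite.\<close>

theorem hall_marriage:
  fixes A :: "'i \<Rightarrow> 'b set"
  assumes "finite I"
    and "\<And>J. J \<subseteq> I \<Longrightarrow> card J \<le> card (\<Union>k\<in>J. A k)"
  shows "\<exists>f. inj_on f I \<and> (\<forall>k\<in>I. f k \<in> A k)"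
  using assms
proof (induction I arbitrary: A rule: finite_psubset_induct)
  case (psubset I)
  consider "I = {}"
    | J where "J \<subset> I" "J \<noteq> {}" "card (\<Union>k\<in>J. A k) \<le> card J"
    | x where "x \<in> I" "\<And>J. J \<subset> I \<Longrightarrow> J \<noteq> {} \<Longrightarrow> card J < card (\<Union>k\<in>J. A k)"
    by (metis ex_in_conv not_le)
  then show ?case
  proof cases
    case 1
    then show ?thesis by simp
  next
    case (2 J)
    let ?U = "\<Union>k\<in>J. A k"
    have "\<exists>f. inj_on f J \<and> (\<forall>k\<in>J. f k \<in> A k)"
      using 2(1) psubset.prems by (intro psubset.IH) auto
    then obtain f where f: "inj_on f J" "\<forall>k\<in>J. f k \<in> A k" by blast
    have "\<exists>g. inj_on g (I - J) \<and> (\<forall>k\<in>I - J. g k \<in> A k - ?U)"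
    proof (intro psubset.IH)
      show "I - J \<subset> I" using 2 by blast
      fix L assume L: "L \<subseteq> I - J"
      have "finite L" "finite J" using L 2(1) psubset.hyps by (auto intro: finite_subset)
      \<comment> \<open>Hall's condition for \<open>L \<union> J\<close> passes to \<open>L\<close>
        with \<open>?U\<close> removed, because \<open>J\<close> is tight: \<open>?U\<close>
        accounts for no more than \<open>card J\<close> elements.\<close>
      then have "card L + card J = card (L \<union> J)"
        using L by (subst card_Un_disjoint) auto
      also have "\<dots> \<le> card (\<Union>k\<in>L \<union> J. A k)"
        using L 2(1) by (intro psubset.prems) auto
      also have "(\<Union>k\<in>L \<union> J. A k) = (\<Union>k\<in>L. A k - ?U) \<union> ?U" by auto
      also have "card \<dots> \<le> card (\<Union>k\<in>L. A k - ?U) + card ?U" by (rule card_Un_le)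
      finally show "card L \<le> card (\<Union>k\<in>L. A k - ?U)" using 2(3) by simp
    qed
    then obtain g where g: "inj_on g (I - J)" "\<forall>k\<in>I - J. g k \<in> A k - ?U" by blast
    have "f x \<noteq> g y" if "x \<in> J" "y \<in> I - J" for x y
    proof -
      have "f x \<in> ?U" "g y \<notin> ?U" using that f(2) g(2) by blast+
      then show ?thesis by metis
    qed
    then have "inj_on (\<lambda>k. if k \<in> J then f k else g k) (J \<union> (I - J))"
      unfolding inj_on_Un using f(1) g(1) by (auto simp: inj_on_def)
    moreover have "J \<union> (I - J) = I" using 2(1) by blast
    ultimately have "inj_on (\<lambda>k. if k \<in> J then f k else g k) I" by simp
    then show ?thesis
      using f g by (intro exI[of _ "\<lambda>k. if k \<in> J then f k else g k"]) auto
  next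
    case (3 x)
    have "card {x} \<le> card (A x)" using psubset.prems[of "{x}"] 3(1) by simp
    then obtain a where a: "a \<in> A x" by fastforce
    have "\<exists>g. inj_on g (I - {x}) \<and> (\<forall>k\<in>I - {x}. g k \<in> A k - {a})"
    proof (intro psubset.IH)
      show "I - {x} \<subset> I" using 3(1) by blast
      fix J assume J: "J \<subseteq> I - {x}"
      show "card J \<le> card (\<Union>k\<in>J. A k - {a})"
      proof (cases "J = {}")
        case False
        have "J \<subset> I" using J 3(1) by blast
        \<comment> \<open>Removing \<open>a\<close> costs at most one element, which the strict
          surplus absorbs.\<close>
        then have "card J < card (\<Union>k\<in>J. A k)" using False 3(2) by blast
        also have "\<dots> \<le> card ((\<Union>k\<in>J. A k) - {a}) + 1"
          unfolding card_Diff_singleton_if by (split if_split) linarith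
        also have "(\<Union>k\<in>J. A k) - {a} = (\<Union>k\<in>J. A k - {a})" by blast
        finally show ?thesis by simp
      qed simp
    qed
    then obtain g where g: "inj_on g (I - {x})" "\<forall>k\<in>I - {x}. g k \<in> A k - {a}" by blast
    have "inj_on (g(x := a)) I"
      using g by (auto simp: inj_on_def)
    moreover have "\<forall>k\<in>I. (g(x := a)) k \<in> A k"
      using g(2) a by simp
    ultimately show ?thesis by blast
  qed
qed

section \<open>From covers with outside representatives to digraphs\<close>

lemma bounded_edge_clique_coversD:
  assumes "\<C> \<in> bounded_edge_clique_covers G i j"
  shows "\<And>C. C \<in> \<C> \<Longrightarrow> clique G C"
    and "\<And>u v. (u, v) \<in> parcs G \<Longrightarrow> \<exists>C\<in>\<C>. u \<in> C \<and> v \<in> C"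
    and "\<And>C. C \<in> \<C> \<Longrightarrow> C \<subseteq> pverts G"
    and "\<And>C. C \<in> \<C> \<Longrightarrow> card C \<le> i"
    and "\<And>v. v \<in> pverts G \<Longrightarrow> card {C \<in> \<C>. v \<in> C} \<le> j"
    and "card \<C> \<le> card (pverts G)"
  using assms
  by (auto simp: bounded_edge_clique_covers_def edge_clique_cover_def clique_def)

lemma finite_bounded_edge_clique_cover:
  assumes "finite (pverts G)" and "\<C> \<in> bounded_edge_clique_covers G i j"
  shows "finite \<C>" and "\<And>C. C \<in> \<C> \<Longrightarrow> finite C"
proof -
  have "\<C> \<subseteq> Pow (pverts G)" using bounded_edge_clique_coversD(3)[OF assms(2)] by blast
  then show "finite \<C>" and "\<And>C. C \<in> \<C> \<Longrightarrow> finite C"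
    using assms(1) by (auto intro: finite_subset)
qed

text \<open>Let every member of a clique \<open>C\<close> send an arc to \<open>f C\<close>. Since
  \<open>f C\<close> lies outside \<open>C\<close>, there are no loops; since \<open>f\<close> is
  injective, the in-neighbourhood of \<open>f C\<close> is exactly \<open>C\<close>. Hence indegrees
  are clique sizes, outdegrees count the cliques at a vertex, and sharing an out-neighbour means
  sharing a clique.\<close>

lemma bounded_competition_graph_if_outside_representatives:
  assumes "pair_graph G" and cover: "\<C> \<in> bounded_edge_clique_covers G i j"
    and inj: "inj_on f \<C>" and f: "\<And>C. C \<in> \<C> \<Longrightarrow> f C \<in> pverts G - C"
  shows "bounded_competition_graph i j G"
proof -
  interpret G: pair_graph G by fact
  note cover = bounded_edge_clique_coversD[OF cover]
    finite_bounded_edge_clique_cover[OF G.pair_finite_verts cover]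
  define D where "D = \<lparr> pverts = pverts G, parcs = {(u, f C) | u C. C \<in> \<C> \<and> u \<in> C} \<rparr>"
  have arc: "(u, w) \<in> parcs D \<longleftrightarrow> (\<exists>C\<in>\<C>. u \<in> C \<and> w = f C)" for u w
    by (auto simp: D_def)
  have verts: "pverts D = pverts G" by (simp add: D_def)
  have "parcs D \<subseteq> pverts G \<times> pverts G" using f cover(3) by (auto simp: D_def)
  moreover from this have "finite (parcs D)"
    by (rule finite_subset) (simp add: G.pair_finite_verts)
  moreover have "u \<noteq> w" if "(u, w) \<in> parcs D" for u w
    using that f by (auto simp: arc)
  ultimately have D: "pair_digraph D"
    by unfold_locales (auto simp: verts G.pair_finite_verts)
  have indeg: "in_degree (with_proj D) w \<le> i" for w
  proof (cases "\<exists>C\<in>\<C>. w = f C")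
    case True
    then obtain C where C: "C \<in> \<C>" "w = f C" by blast
    have "in_arcs (with_proj D) w \<subseteq> (\<lambda>u. (u, w)) ` C"
      using C inj_onD[OF inj] by (fastforce simp: in_arcs_def arc)
    then have "in_degree (with_proj D) w \<le> card C"
      unfolding in_degree_def by (rule surj_card_le[OF cover(8)[OF C(1)]])
    then show ?thesis using cover(4)[OF C(1)] by simp
  next
    case False
    then have "in_arcs (with_proj D) w = {}" by (auto simp: in_arcs_def arc)
    then show ?thesis by (simp add: in_degree_def)
  qed
  have outdeg: "out_degree (with_proj D) v \<le> j" if "v \<in> pverts G" for v
  proof -
    have "out_arcs (with_proj D) v \<subseteq> (\<lambda>C. (v, f C)) ` {C \<in> \<C>. v \<in> C}"
      by (auto simp: out_arcs_def arc)
    then have "out_degree (with_proj D) v \<le> card {C \<in> \<C>. v \<in> C}"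
      unfolding out_degree_def by (intro surj_card_le) (use cover(7) in auto)
    then show ?thesis using cover(5)[OF that] by simp
  qed
  have "(u, v) \<in> parcs G \<longleftrightarrow> u \<in> pverts G \<and> v \<in> pverts G \<and> u \<noteq> v \<and>
    (\<exists>w\<in>pverts D. (u, w) \<in> parcs D \<and> (v, w) \<in> parcs D)" (is "_ \<longleftrightarrow> ?R") for u v
  proof
    assume uv: "(u, v) \<in> parcs G"
    then obtain C where "C \<in> \<C>" "u \<in> C" "v \<in> C" using cover(2) by blast
    then show ?R using uv f[of C] G.in_arcsD1 G.in_arcsD2 G.no_loops'
      by (auto simp: verts arc intro!: bexI[of _ "f C"])
  next
    assume R: ?R
    then obtain C C' where "C \<in> \<C>" "u \<in> C" "C' \<in> \<C>" "v \<in> C'" "f C = f C'"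
      by (auto simp: arc)
    moreover from this have "C = C'" using inj by (auto dest: inj_onD)
    ultimately show "(u, v) \<in> parcs G" using R cover(1)[of C] by (auto simp: clique_def)
  qed
  then have "G = competition_graph D"
    by (auto simp: competition_graph_def verts intro!: pair_pre_digraph.equality)
  then show ?thesis
    using D indeg outdeg verts
    by (auto simp: bounded_competition_graph_def bounded_digraph_def)
qed

text \<open>Handles the case where the vertex set itself is a clique of the cover and so has no
  outside representative. An edge avoiding \<open>a\<close> or \<open>b\<close> lies in the
  complement of that vertex, and the only other edge is \<open>ab\<close>. The three cliques are
  represented by \<open>a\<close>, \<open>b\<close> and a third vertex \<open>c\<close>.\<close>

lemma bounded_competition_graph_complete:
  assumes "pair_graph G" and clique: "clique G (pverts G)"
    and "3 \<le> card (pverts G)" and "card (pverts G) \<le> i" and "2 \<le> j"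
  shows "bounded_competition_graph i j G"
proof -
  interpret G: pair_graph G by fact
  let ?V = "pverts G"
  obtain T where "T \<subseteq> ?V" "card T = 3" using obtain_subset_with_card_n[OF assms(3)] by metis
  then obtain a b c where abc: "a \<in> ?V" "b \<in> ?V" "c \<in> ?V" "a \<noteq> b" "a \<noteq> c" "b \<noteq> c"
    by (auto simp: card_3_iff)
  define \<C> where "\<C> = {?V - {a}, ?V - {b}, {a, b}}"
  have deg: "card {C \<in> \<C>. v \<in> C} \<le> j" for v
  proof -
    have le: "card {X, Y} \<le> j" for X Y :: "'a set"
      using assms(5) card_insert_le_m1[of 2 "{Y}" X] by simp
    \<comment> \<open>The vertices \<open>a\<close> and \<open>b\<close> each miss one of the two
      large cliques, and only they lie in \<open>{a, b}\<close>; in the witness,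
      \<open>{a, b}\<close> takes the place of the missed clique.\<close>
    obtain X Y where "{C \<in> \<C>. v \<in> C} \<subseteq> {X, Y}"
    proof
      show "{C \<in> \<C>. v \<in> C} \<subseteq> {if v = a then {a, b} else ?V - {a}, if v = b then {a, b} else ?V - {b}}"
        by (auto simp: \<C>_def)
    qed
    then have "card {C \<in> \<C>. v \<in> C} \<le> card {X, Y}" by (intro card_mono) auto
    with le show ?thesis by (rule order_trans[rotated])
  qed
  have "clique G C" if "C \<in> \<C>" for C
    using that clique abc by (auto simp: \<C>_def clique_def)
  moreover have "\<exists>C\<in>\<C>. u \<in> C \<and> v \<in> C" if "(u, v) \<in> parcs G" for u v
    using G.in_arcsD1[OF that] G.in_arcsD2[OF that] abc(4) by (auto simp: \<C>_def)
  moreover have "card C \<le> i" if "C \<in> \<C>" for C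
    using that assms(3,4) abc by (auto simp: \<C>_def)
  moreover have "card \<C> \<le> card ?V"
    using assms(3) card_length[of "[?V - {a}, ?V - {b}, {a, b}]"] by (simp add: \<C>_def)
  ultimately have "\<C> \<in> bounded_edge_clique_covers G i j"
    using deg by (auto simp: bounded_edge_clique_covers_def edge_clique_cover_def)
  moreover
  define f where "f C = (if a \<notin> C then a else if b \<notin> C then b else c)" for C
  have "inj_on f \<C>"
    using abc by (auto simp: inj_on_def f_def \<C>_def)
  moreover have "f C \<in> ?V - C" if "C \<in> \<C>" for C
    using that abc by (auto simp: f_def \<C>_def)
  ultimately show ?thesis
    by (intro bounded_competition_graph_if_outside_representatives[OF assms(1)])
qed

section \<open>Covers of least total size and Hall's condition\<close>

text \<open>Otherwise every edge from \<open>v\<close> inside \<open>C\<close> is also covered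
  elsewhere, so \<open>v\<close> can be deleted from \<open>C\<close>, which lowers the total size.
  In particular a singleton never occurs in a least cover.\<close>

lemma private_edge_if_least_total_size:
  assumes "pair_graph G" and cover: "\<C> \<in> bounded_edge_clique_covers G i j"
    and least: "\<And>\<C>'. \<C>' \<in> bounded_edge_clique_covers G i j \<Longrightarrow> sum card \<C> \<le> sum card \<C>'"
    and C: "C \<in> \<C>" "v \<in> C"
  shows "\<exists>u\<in>C. u \<noteq> v \<and> (\<forall>C'\<in>\<C>. u \<in> C' \<and> v \<in> C' \<longrightarrow> C' = C)"
proof (rule ccontr)
  assume "\<not> ?thesis"
  then have other: "\<exists>C'\<in>\<C>. u \<in> C' \<and> v \<in> C' \<and> C' \<noteq> C" if "u \<in> C" "u \<noteq> v" for u
    using that by blast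
  interpret G: pair_graph G by fact
  note cover = bounded_edge_clique_coversD[OF cover]
    finite_bounded_edge_clique_cover[OF G.pair_finite_verts cover]
  \<comment> \<open>\<open>C - {v}\<close> may be empty or coincide with another member of the
    cover. Both are harmless: the empty set is a clique, and merging members only lowers the counts
    and the total size.\<close>
  define g where "g X = (if X = C then C - {v} else X)" for X
  have g_le: "card (g X) \<le> card X" for X by (simp add: g_def card_Diff1_le)
  have "clique G X" if "X \<in> g ` \<C>" for X
    using that cover(1) C by (auto simp: g_def clique_def)
  moreover have "\<exists>X\<in>g ` \<C>. x \<in> X \<and> y \<in> X" if xy: "(x, y) \<in> parcs G" for x y
  proof -
    obtain X where X: "X \<in> \<C>" "x \<in> X" "y \<in> X" using cover(2)[OF xy] by blast
    have "x \<noteq> y" using xy G.no_loops' by blast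
    then have "\<exists>X\<in>\<C>. x \<in> g X \<and> y \<in> g X"
      using X other[of x] other[of y] by (cases "X = C"; cases "x = v"; cases "y = v")
        (auto simp: g_def)
    then show ?thesis by blast
  qed
  moreover have "card X \<le> i" if "X \<in> g ` \<C>" for X
    using that cover(4) g_le order_trans by blast
  moreover have "card {X \<in> g ` \<C>. w \<in> X} \<le> j" if "w \<in> pverts G" for w
  proof -
    have "{X \<in> g ` \<C>. w \<in> X} \<subseteq> g ` {X \<in> \<C>. w \<in> X}" by (auto simp: g_def split: if_splits)
    then have "card {X \<in> g ` \<C>. w \<in> X} \<le> card {X \<in> \<C>. w \<in> X}"
      using cover(7) by (intro surj_card_le) auto
    then show ?thesis using cover(5)[OF that] by simp
  qed
  moreover have "card (g ` \<C>) \<le> card (pverts G)"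
    using cover(6) card_image_le[OF cover(7)] order_trans by blast
  ultimately have "g ` \<C> \<in> bounded_edge_clique_covers G i j"
    by (auto simp: bounded_edge_clique_covers_def edge_clique_cover_def)
  then have "sum card \<C> \<le> sum card (g ` \<C>)" by (rule least)
  also have "\<dots> \<le> (\<Sum>X\<in>\<C>. card (g X))"
    using sum_image_le[OF cover(7), of card g] by simp
  also have "\<dots> < sum card \<C>"
  proof (rule sum_strict_mono_ex1)
    have "card (g C) < card C"
      using card_Diff1_less[OF cover(8)[OF C(1)] C(2)] unfolding g_def by presburger
    then show "\<exists>X\<in>\<C>. card (g X) < card X" using C by blast
  qed (use g_le cover(7) in auto)
  finally show False by simp
qed

text \<open>For nonempty \<open>S\<close> the union of complements is the complement of the
  intersection. If the intersection is empty, the bound on the number of cliques suffices; a single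
  clique is a proper subset of \<open>V\<close>. Otherwise private partners of a common vertex give
  an injection of \<open>S\<close> into the union.\<close>

lemma hall_condition_if_private_edges:
  assumes fin: "finite V" and sub: "\<And>C. C \<in> \<C> \<Longrightarrow> C \<subset> V" and "finite \<C>" "card \<C> \<le> card V"
    and private_edge: "\<And>C v. C \<in> \<C> \<Longrightarrow> v \<in> C \<Longrightarrow>
      \<exists>u\<in>C. u \<noteq> v \<and> (\<forall>C'\<in>\<C>. u \<in> C' \<and> v \<in> C' \<longrightarrow> C' = C)"
    and S: "S \<subseteq> \<C>"
  shows "card S \<le> card (\<Union>C\<in>S. V - C)"
proof -
  consider "S = {}" | C where "S = {C}" | "\<Inter>S \<inter> V = {}" "S \<noteq> {}"
    | v C D where "v \<in> \<Inter>S" "C \<in> S" "D \<in> S" "C \<noteq> D"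
    by blast
  then show ?thesis
  proof cases
    case (2 C)
    then have "V - C \<noteq> {}" using sub[of C] S by blast
    then have "card (V - C) > 0" using fin by (simp add: card_gt_0_iff)
    then show ?thesis using 2 by simp
  next
    case 3
    then have "(\<Union>C\<in>S. V - C) = V" by blast
    then show ?thesis using card_mono[OF assms(3) S] assms(4) by simp
  next
    case (4 v C D)
    have "\<forall>X\<in>S. \<exists>u\<in>X. u \<noteq> v \<and> (\<forall>C'\<in>\<C>. u \<in> C' \<and> v \<in> C' \<longrightarrow> C' = X)"
      using private_edge S 4(1) by blast
    \<comment> \<open>\<open>p X\<close> is a private partner of \<open>v\<close> in
      \<open>X\<close>. As \<open>v\<close> lies in every member of \<open>S\<close>, the partner
      \<open>p X\<close> lies in no member other than \<open>X\<close>.\<close>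
    then obtain p where p: "\<And>X. X \<in> S \<Longrightarrow> p X \<in> X"
      "\<And>X Y. X \<in> S \<Longrightarrow> Y \<in> \<C> \<Longrightarrow> p X \<in> Y \<Longrightarrow> v \<in> Y \<Longrightarrow> Y = X"
      by metis
    have "inj_on p S"
      using p S 4(1) by (intro inj_onI) (metis InterD subsetD)
    moreover have "p ` S \<subseteq> (\<Union>C\<in>S. V - C)"
    proof
      fix x assume "x \<in> p ` S"
      then obtain X where X: "X \<in> S" "x = p X" by blast
      \<comment> \<open>A second member is what places \<open>p X\<close> in some
        complement.\<close>
      obtain Y where Y: "Y \<in> S" "Y \<noteq> X" using 4 by metis
      then have "p X \<notin> Y" using p(2)[OF X(1), of Y] S 4(1) by blast
      moreover have "p X \<in> V" using p(1)[OF X(1)] sub[of X] X S by blast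
      ultimately show "x \<in> (\<Union>C\<in>S. V - C)" using X Y by blast
    qed
    ultimately show ?thesis using fin by (intro card_inj_on_le) auto
  qed simp
qed

section \<open>Sufficiency of the three conditions\<close>

lemma bounded_competition_graph_if_cover:
  assumes "pair_graph G" and "j > 0" and "\<not> K\<^bsub>2\<^esub> (with_proj G)"
    and "j = 1 \<longrightarrow> \<not> (\<exists>n \<ge> 2. K\<^bsub>n\<^esub> (with_proj G))"
    and "bounded_edge_clique_covers G i j \<noteq> {}"
  shows "bounded_competition_graph i j G"
proof -
  interpret G: pair_graph G by fact
  let ?V = "pverts G"
  obtain \<C>\<^sub>0 where "\<C>\<^sub>0 \<in> bounded_edge_clique_covers G i j" using assms(5) by blast
  from ex_has_least_nat[of "\<lambda>\<C>. \<C> \<in> bounded_edge_clique_covers G i j", OF this, of "sum card"]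
  obtain \<C> where cover: "\<C> \<in> bounded_edge_clique_covers G i j"
    and least: "\<And>\<C>'. \<C>' \<in> bounded_edge_clique_covers G i j \<Longrightarrow> sum card \<C> \<le> sum card \<C>'"
    by blast
  note coverD = bounded_edge_clique_coversD[OF cover]
    finite_bounded_edge_clique_cover[OF G.pair_finite_verts cover]
  have private_edge: "\<exists>u\<in>C. u \<noteq> v \<and> (\<forall>C'\<in>\<C>. u \<in> C' \<and> v \<in> C' \<longrightarrow> C' = C)"
    if "C \<in> \<C>" "v \<in> C" for C v
    using private_edge_if_least_total_size[OF assms(1) cover _ that] least by blast
  show ?thesis
  proof (cases "?V \<in> \<C>")
    case True
    have clique: "clique G ?V" by (rule coverD(1)[OF True])
    then have "parcs G = {(u, v). (u, v) \<in> ?V \<times> ?V \<and> u \<noteq> v}"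
      unfolding clique_def by (auto dest: G.in_arcsD1 G.in_arcsD2 G.no_loops')
    then have K: "K\<^bsub>card ?V\<^esub> (with_proj G)"
      by (simp add: complete_digraph_pair_def G.pair_finite_verts)
    \<comment> \<open>A nonempty cover has at most \<open>card ?V\<close> members, which rules out
      the null graph; the private partner of \<open>v\<close> then rules out a single
      vertex.\<close>
    have "card ?V > 0"
      using coverD(6) True coverD(7) by (metis card_gt_0_iff empty_iff le_zero_eq neq0_conv)
    then obtain v where v: "v \<in> ?V" by fastforce
    then obtain u where "u \<in> ?V" "u \<noteq> v" using private_edge[OF True v] by blast
    then have "card ?V \<ge> 2"
      using v card_mono[OF G.pair_finite_verts, of "{u, v}"] by simp
    \<comment> \<open>Conditions (i) and (ii) leave at least three vertices and \<open>j\<close> at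
      least 2, as the three-clique cover requires.\<close>
    moreover have "card ?V \<noteq> 2" using K assms(3) by metis
    moreover have "j \<noteq> 1" using K assms(4) \<open>card ?V \<ge> 2\<close> by blast
    ultimately show ?thesis
      using assms(2) coverD(4)[OF True]
      by (intro bounded_competition_graph_complete[OF assms(1) clique]) auto
  next
    case False
    have "\<exists>f. inj_on f \<C> \<and> (\<forall>C\<in>\<C>. f C \<in> ?V - C)"
    proof (rule hall_marriage)
      fix S assume S: "S \<subseteq> \<C>"
      have "C \<subset> ?V" if "C \<in> \<C>" for C
        using that False coverD(3)[OF that] by blast
      then show "card S \<le> card (\<Union>C\<in>S. ?V - C)"
        by (rule hall_condition_if_private_edges[OF G.pair_finite_verts _ coverD(7,6) private_edge S])
    qed (rule coverD(7))
    then show ?thesis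
      using bounded_competition_graph_if_outside_representatives[OF assms(1) cover] by blast
  qed
qed

section \<open>Necessity of the three conditions\<close>

text \<open>Vertices with a common out-neighbour are adjacent, so in-neighbourhoods are cliques, and
  each edge has such a witness. Equal in-neighbourhoods of different vertices collapse in the image,
  so the degree and size bounds are inequalities.\<close>

lemma in_neighbourhoods_bounded_edge_clique_cover:
  assumes "bounded_digraph i j D"
  shows "(\<lambda>w. {u. (u, w) \<in> parcs D}) ` pverts D
    \<in> bounded_edge_clique_covers (competition_graph D) i j" (is "?N ` _ \<in> _")
proof -
  interpret D: pair_digraph D using assms by (simp add: bounded_digraph_def)
  let ?G = "competition_graph D"
  have verts: "pverts ?G = pverts D" by (simp add: competition_graph_def)
  have "clique ?G (?N w)" if "w \<in> pverts D" for w
    using that D.in_arcsD1 by (auto simp: clique_def competition_graph_def)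
  moreover have "\<exists>C\<in>?N ` pverts D. u \<in> C \<and> v \<in> C" if "(u, v) \<in> parcs ?G" for u v
    using that by (auto simp: competition_graph_def)
  moreover have "card (?N w) \<le> i" if "w \<in> pverts D" for w
  proof -
    have "?N w = fst ` in_arcs (with_proj D) w" by (force simp: in_arcs_def)
    then have "card (?N w) \<le> in_degree (with_proj D) w"
      using D.pair_finite_arcs by (auto simp: in_degree_def in_arcs_def intro!: card_image_le)
    then show ?thesis using assms that by (fastforce simp: bounded_digraph_def)
  qed
  moreover have "card {C \<in> ?N ` pverts D. v \<in> C} \<le> j" if "v \<in> pverts D" for v
  proof -
    \<comment> \<open>Each clique containing \<open>v\<close> is the in-neighbourhood of the head of
      some arc leaving \<open>v\<close>.\<close>
    have "{C \<in> ?N ` pverts D. v \<in> C} \<subseteq> (\<lambda>e. ?N (snd e)) ` out_arcs (with_proj D) v"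
      by (force simp: out_arcs_def)
    then have "card {C \<in> ?N ` pverts D. v \<in> C} \<le> out_degree (with_proj D) v"
      unfolding out_degree_def
      using D.pair_finite_arcs by (intro surj_card_le) (auto simp: out_arcs_def)
    then show ?thesis using assms that by (fastforce simp: bounded_digraph_def)
  qed
  moreover have "card (?N ` pverts D) \<le> card (pverts D)"
    by (rule card_image_le[OF D.pair_finite_verts])
  ultimately show ?thesis
    unfolding bounded_edge_clique_covers_def edge_clique_cover_def verts by blast
qed

text \<open>A common out-neighbour of the only two vertices would be one of them and carry a
  loop.\<close>

lemma competition_graph_not_K2:
  assumes "pair_digraph D"
  shows "\<not> K\<^bsub>2\<^esub> (with_proj (competition_graph D))"
proof
  interpret D: pair_digraph D by fact
  assume "K\<^bsub>2\<^esub> (with_proj (competition_graph D))"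
  then have K: "card (pverts D) = 2"
    "parcs (competition_graph D) = {(u, v). (u, v) \<in> pverts D \<times> pverts D \<and> u \<noteq> v}"
    by (auto simp: complete_digraph_pair_def competition_graph_def)
  then obtain a b where ab: "pverts D = {a, b}" "a \<noteq> b" by (auto simp: card_2_iff)
  then have "(a, b) \<in> parcs (competition_graph D)" using K by simp
  then obtain w where "w \<in> {a, b}" "(a, w) \<in> parcs D" "(b, w) \<in> parcs D"
    using ab by (auto simp: competition_graph_def)
  then show False using D.no_loops' by auto
qed

text \<open>With outdegree at most one, all vertices of a complete competition graph would have the same
  out-neighbour, which would then carry a loop.\<close>

lemma competition_graph_not_complete_if_outdegree_1:
  assumes "bounded_digraph i 1 D" and "n \<ge> 2"
  shows "\<not> K\<^bsub>n\<^esub> (with_proj (competition_graph D))"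
proof
  interpret D: pair_digraph D using assms by (simp add: bounded_digraph_def)
  assume "K\<^bsub>n\<^esub> (with_proj (competition_graph D))"
  then have K: "card (pverts D) = n"
    "parcs (competition_graph D) = {(u, v). (u, v) \<in> pverts D \<times> pverts D \<and> u \<noteq> v}"
    by (auto simp: complete_digraph_pair_def competition_graph_def)
  have common: "\<exists>w\<in>pverts D. (u, w) \<in> parcs D \<and> (v, w) \<in> parcs D"
    if "u \<in> pverts D" "v \<in> pverts D" "u \<noteq> v" for u v
  proof -
    have "(u, v) \<in> parcs (competition_graph D)" using that K by simp
    then show ?thesis by (simp add: competition_graph_def)
  qed
  have unique: "x = y" if "(u, x) \<in> parcs D" "(u, y) \<in> parcs D" for u x y
  proof -
    have "card (out_arcs (with_proj D) u) \<le> 1"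
      using assms(1) D.in_arcsD1[OF that(1)] by (auto simp: bounded_digraph_def out_degree_def)
    moreover have "finite (out_arcs (with_proj D) u)"
      using D.pair_finite_arcs by (simp add: out_arcs_def)
    moreover have "(u, x) \<in> out_arcs (with_proj D) u" "(u, y) \<in> out_arcs (with_proj D) u"
      using that by (auto simp: out_arcs_def)
    ultimately have "(u, x) = (u, y)" by (metis One_nat_def card_le_Suc0_iff_eq)
    then show ?thesis by simp
  qed
  obtain T where "T \<subseteq> pverts D" "card T = 2"
    using obtain_subset_with_card_n assms(2) K(1) by metis
  then obtain a b where ab: "a \<in> pverts D" "b \<in> pverts D" "a \<noteq> b" by (auto simp: card_2_iff)
  \<comment> \<open>\<open>b\<close> only supplies an out-neighbour \<open>w\<close> of
    \<open>a\<close>. The loop comes from the pair \<open>a\<close>, \<open>w\<close>: their common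
    out-neighbour must again be \<open>w\<close>.\<close>
  then obtain w where w: "w \<in> pverts D" "(a, w) \<in> parcs D" using common by blast
  then have "a \<noteq> w" using D.no_loops' by blast
  then obtain x where x: "(a, x) \<in> parcs D" "(w, x) \<in> parcs D" using common ab w by blast
  then have "x = w" using unique w by blast
  then show False using x D.no_loops' by blast
qed

theorem theorem2p7:
  fixes G :: "'a pair_pre_digraph" and i j :: nat
  assumes "pair_graph G" and "i > 0" and "j > 0"
  shows "bounded_competition_graph i j G \<longleftrightarrow>
    \<not> K\<^bsub>2\<^esub> (with_proj G) \<and>
    (j = 1 \<longrightarrow> \<not> (\<exists>n \<ge> 2. K\<^bsub>n\<^esub> (with_proj G))) \<and>
    bounded_edge_clique_covers G i j \<noteq> {}"
proof
  assume "bounded_competition_graph i j G"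
  then obtain D where D: "bounded_digraph i j D" "G = competition_graph D"
    by (auto simp: bounded_competition_graph_def)
  moreover have "pair_digraph D" using D by (simp add: bounded_digraph_def)
  ultimately show "\<not> K\<^bsub>2\<^esub> (with_proj G) \<and>
    (j = 1 \<longrightarrow> \<not> (\<exists>n \<ge> 2. K\<^bsub>n\<^esub> (with_proj G))) \<and>
    bounded_edge_clique_covers G i j \<noteq> {}"
    using competition_graph_not_K2 competition_graph_not_complete_if_outdegree_1
      in_neighbourhoods_bounded_edge_clique_cover by blast
qed (use bounded_competition_graph_if_cover assms in blast)

end
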